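(* Let $F:\mathbb{R}^n\times\mathbb{R}^p\to\mathbb{R}\cup\{\infty\}$ be a proper, lower semicontinuous, convex function with marginal function $m(x):=\inf_{y\in\mathbb{R}^p}F(x,y)$, $x\in\mathbb{R}^n$. Assume that $m$ is proper and lower semicontinuous with $\mathrm{dom}\,m$ unbounded, and that the infimum is attained for every $x\in\mathrm{dom}\,m$. Then, with $I=\{1,\dots,n\}\subset\{1,\dots,n+p\}$, $$\partial m(\infty)\subset\bigl\{u\in\mathbb{R}^n\mid(u,0)\in\partial F(\infty_I)\bigr\}.$$
   Context: Proper functions take values in $\mathbb{R}\cup\{\infty\}$ and have nonempty domain; $\mathrm{dom}$ is the set where the function is $<\infty$; $\mathrm{epi}\,\varphi=\{(z,r)\mid r\ge\varphi(z)\}$. For a nonempty convex set $E\subset\mathbb{R}^q$ and a nonempty index set $I\subset\{1,\dots,q\}$ with $\pi_I(z)=(z_i)_{i\in I}$: $T(\infty_I;E)$ is the set of $w\in\mathbb{R}^q$ such that for all sequences $z_k\in E$ with $\|\pi_I(z_k)\|\to\infty$ and all $t_k>0$ with $t_k\to0$ there exist $w_k\to w$ with $z_k+t_kw_k\in E$ for all $k$; $N(\infty_I;E)=\{v\mid\langle v,w\rangle\le0\ \forall w\in T(\infty_I;E)\}$. $\partial m(\infty)=\{u\in\mathbb{R}^n\mid(u,-1)\in N(\infty_I;\mathrm{epi}\,m)\}$, where $\mathrm{epi}\,m\subset\mathbb{R}^{n+1}$ and $I=\{1,\dots,n\}$ selects the $x$-coordinates. $\partial F(\infty_I)=\{z^*\in\mathbb{R}^{n+p}\mid(z^*,-1)\in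 N(\infty_I;\mathrm{epi}\,F)\}$, where $\mathrm{epi}\,F\subset\mathbb{R}^{n+p+1}$ and $I=\{1,\dots,n\}$ again selects only the $x$-coordinates (so in the defining sequences $(x_k,y_k,r_k)\in\mathrm{epi}\,F$ one requires $\|x_k\|\to\infty$). *)

theory Defs
  imports "HOL-Analysis.Analysis"
begin

text \<open>
  Functions into \<open>\<real> \<union> {\<infinity>}\<close> are rendered as \<^typ>\<open>ereal\<close>-valued functions;
  \<open>proper_fun\<close> excludes the value \<open>-\<infinity>\<close>.
\<close>

definition dom_ext :: "('a \<Rightarrow> ereal) \<Rightarrow> 'a set" where
  "dom_ext f = {x. f x < \<infinity>}"

definition epi :: "('a \<Rightarrow> ereal) \<Rightarrow> ('a \<times> real) set" where
  "epi f = {(x, r). f x \<le> ereal r}"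

definition proper_fun :: "('a \<Rightarrow> ereal) \<Rightarrow> bool" where
  "proper_fun f \<longleftrightarrow> (\<forall>x. f x \<noteq> -\<infinity>) \<and> dom_ext f \<noteq> {}"

definition lsc_fun :: "('a::topological_space \<Rightarrow> ereal) \<Rightarrow> bool" where
  "lsc_fun f \<longleftrightarrow> (\<forall>x. f x \<le> Liminf (at x) f)"

text \<open>
  Used only for functions that avoid \<open>-\<infinity>\<close>, so that no sum \<open>\<infinity> + (-\<infinity>)\<close> occurs; at
  the endpoints \<open>t = 0\<close> and \<open>t = 1\<close> the \<^typ>\<open>ereal\<close> convention \<open>0 * \<infinity> = 0\<close> makes the
  inequality trivial.
\<close>

definition convex_fun :: "('a::real_vector \<Rightarrow> ereal) \<Rightarrow> bool" where
  "convex_fun f \<longleftrightarrow>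
     (\<forall>x y. \<forall>t\<in>{0..1}. f ((1 - t) *\<^sub>R x + t *\<^sub>R y) \<le> ereal (1 - t) * f x + ereal t * f y)"

definition marginal :: "('a \<times> 'b \<Rightarrow> ereal) \<Rightarrow> 'a \<Rightarrow> ereal" where
  "marginal F x = (INF y. F (x, y))"

text \<open>
  The index set \<open>I\<close> is given as a set of standard basis vectors, \<open>I \<subseteq> Basis\<close>, and the
  coordinate projection \<open>z \<mapsto> (z\<^sub>i)\<close>, \<open>i \<in> I\<close>, keeps its values in the ambient space, with the
  coordinates outside \<open>I\<close> set to zero; its norm is the Euclidean norm of the selected
  coordinates.
\<close>

definition coord_proj :: "'a::euclidean_space set \<Rightarrow> 'a \<Rightarrow> 'a" where
  "coord_proj I z = (\<Sum>i\<in>I. (z \<bullet> i) *\<^sub>R i)"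

definition tangent_inf :: "'a::euclidean_space set \<Rightarrow> 'a set \<Rightarrow> 'a set" where
  "tangent_inf I E =
     {w. \<forall>z t. (\<forall>k. z k \<in> E) \<longrightarrow>
               filterlim (\<lambda>k. norm (coord_proj I (z k))) at_top sequentially \<longrightarrow>
               (\<forall>k. 0 < t k) \<longrightarrow> t \<longlonglongrightarrow> (0::real) \<longrightarrow>
               (\<exists>v. v \<longlonglongrightarrow> w \<and> (\<forall>k::nat. z k + t k *\<^sub>R v k \<in> E))}"

definition normal_inf :: "'a::euclidean_space set \<Rightarrow> 'a set \<Rightarrow> 'a set" where
  "normal_inf I E = {v. \<forall>w\<in>tangent_inf I E. v \<bullet> w \<le> 0}"

text \<open>
  Here \<open>I\<close> selects coordinates of the domain of \<open>f\<close>; the image under \<open>i \<mapsto> (i, 0)\<close> selects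
  the same coordinates in the product that contains the epigraph.
\<close>

definition subdiff_inf :: "'a::euclidean_space set \<Rightarrow> ('a \<Rightarrow> ereal) \<Rightarrow> 'a set" where
  "subdiff_inf I f = {u. (u, -1) \<in> normal_inf ((\<lambda>i. (i, 0)) ` I) (epi f)}"

end

theory Submission
  imports Defs
begin

text \<open>
  The projection \<open>((a, b), c) \<mapsto> (a, c)\<close> maps \<open>T(\<infinity>\<^sub>I; epi F)\<close> into \<open>T(\<infinity>; epi m)\<close>:
  a sequence \<open>(x\<^sub>k, r\<^sub>k)\<close> in \<open>epi m\<close> lifts to \<open>((x\<^sub>k, y\<^sub>k), r\<^sub>k)\<close> in \<open>epi F\<close> because the infimum
  is attained, and the correcting sequence in \<open>epi F\<close> projects back to \<open>epi m\<close>. The inclusion of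
  subdifferentials follows by polarity.
\<close>

text \<open>Embedded vectors \<open>(i, 0)\<close> are orthogonal to the second factor, so
  divergence along \<open>I\<close> can be tested on the first component alone.\<close>

lemma norm_coord_proj_embed:
  "norm (coord_proj ((\<lambda>i. (i, 0)) ` I) z) = norm (coord_proj I (fst z))"
proof -
  have "coord_proj ((\<lambda>i. (i, 0)) ` I) z = (\<Sum>i\<in>I. ((fst z \<bullet> i) *\<^sub>R i, 0))"
    unfolding coord_proj_def
    by (subst sum.reindex) (auto simp: inj_on_def inner_prod_def intro!: sum.cong)
  also have "\<dots> = (coord_proj I (fst z), 0)"
    by (simp add: coord_proj_def sum_prod)
  finally show ?thesis
    by (simp add: norm_Pair)
qed

lemma marginal_le: "marginal F x \<le> F (x, y)"
  unfolding marginal_def by (rule INF_lower) simp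

lemma epi_marginal_project:
  assumes "((x, y), r) \<in> epi F"
  shows "(x, r) \<in> epi (marginal F)"
  using assms order_trans[OF marginal_le[of F x y]] by (simp add: epi_def)

text \<open>A minimizer \<open>y\<close> keeps the height \<open>r\<close> even in the boundary case
  \<open>r = marginal F x\<close>, where a near-minimizer could lie above \<open>r\<close>.\<close>

lemma epi_marginal_lift:
  assumes "\<forall>x\<in>dom_ext (marginal F). \<exists>y. F (x, y) = marginal F x"
    and "(x, r) \<in> epi (marginal F)"
  obtains y where "((x, y), r) \<in> epi F"
proof -
  have "marginal F x \<le> ereal r"
    using assms(2) by (simp add: epi_def)
  then have "x \<in> dom_ext (marginal F)"
    by (auto simp: dom_ext_def)
  with assms(1) obtain y where "F (x, y) = marginal F x"
    by blast
  with \<open>marginal F x \<le> ereal r\<close> show ?thesis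
    by (intro that[of y]) (simp add: epi_def)
qed

lemma tangent_inf_epi_marginal:
  fixes F :: "'a::euclidean_space \<times> 'b::euclidean_space \<Rightarrow> ereal"
  assumes att: "\<forall>x\<in>dom_ext (marginal F). \<exists>y. F (x, y) = marginal F x"
    and w: "((a, b), c) \<in> tangent_inf ((\<lambda>i. (i, 0)) ` (\<lambda>i. (i, 0)) ` I) (epi F)"
  shows "(a, c) \<in> tangent_inf ((\<lambda>i. (i, 0)) ` I) (epi (marginal F))"
  unfolding tangent_inf_def
proof (intro CollectI allI impI)
  fix z :: "nat \<Rightarrow> 'a \<times> real" and t :: "nat \<Rightarrow> real"
  assume z: "\<forall>k. z k \<in> epi (marginal F)"
    and lim: "filterlim (\<lambda>k. norm (coord_proj ((\<lambda>i. (i, 0)) ` I) (z k))) at_top sequentially"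
    and t: "\<forall>k. 0 < t k" "t \<longlonglongrightarrow> 0"
  have "\<exists>y. ((fst (z k), y), snd (z k)) \<in> epi F" for k
    using epi_marginal_lift[OF att, of "fst (z k)" "snd (z k)"] z by auto
  then obtain y where y: "((fst (z k), y k), snd (z k)) \<in> epi F" for k
    by metis
  define zF where "zF k = ((fst (z k), y k), snd (z k))" for k
  \<comment> \<open>Two embeddings are peeled off here and one in \<open>lim\<close>; both leave the
    norm of the projected \<open>fst (z k)\<close>, so \<open>y k\<close> may behave
    arbitrarily.\<close>
  have "filterlim (\<lambda>k. norm (coord_proj ((\<lambda>i. (i, 0)) ` (\<lambda>i. (i, 0)) ` I) (zF k)))
      at_top sequentially"
    using lim by (simp add: norm_coord_proj_embed zF_def)
  moreover have "\<forall>k. zF k \<in> epi F"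
    using y by (simp add: zF_def)
  ultimately obtain v where v: "v \<longlonglongrightarrow> ((a, b), c)" "\<forall>k. zF k + t k *\<^sub>R v k \<in> epi F"
    using w[unfolded tangent_inf_def, THEN CollectD, rule_format, of zF t] t by blast
  let ?v = "\<lambda>k. (fst (fst (v k)), snd (v k))"
  have "?v \<longlonglongrightarrow> (a, c)"
    using tendsto_Pair[OF tendsto_fst[OF tendsto_fst[OF v(1)]] tendsto_snd[OF v(1)]] by simp
  moreover have "z k + t k *\<^sub>R ?v k \<in> epi (marginal F)" for k
  proof -
    \<comment> \<open>The discarded component of \<open>v k\<close> moves \<open>y k\<close> to a
      point that witnesses membership of the shifted pair in the epigraph of the marginal.\<close>
    have eq: "zF k + t k *\<^sub>R v k
        = ((fst (z k + t k *\<^sub>R ?v k), y k + t k *\<^sub>R snd (fst (v k))), snd (z k + t k *\<^sub>R ?v k))"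
      by (simp add: zF_def prod_eq_iff)
    then show ?thesis
      using epi_marginal_project[OF v(2)[rule_format, of k, unfolded eq]]
      by (simp only: prod.collapse)
  qed
  ultimately show "\<exists>v. v \<longlonglongrightarrow> (a, c) \<and> (\<forall>k. z k + t k *\<^sub>R v k \<in> epi (marginal F))"
    by blast
qed

theorem proposition4p24:
  fixes F :: "(real ^ 'n) \<times> (real ^ 'p) \<Rightarrow> ereal"
  assumes "proper_fun F" and "lsc_fun F" and "convex_fun F"
    and "proper_fun (marginal F)" and "lsc_fun (marginal F)"
    and "\<not> bounded (dom_ext (marginal F))"
    and "\<forall>x\<in>dom_ext (marginal F). \<exists>y. F (x, y) = marginal F x"
  shows "subdiff_inf Basis (marginal F)
           \<subseteq> {u. (u, 0) \<in> subdiff_inf ((\<lambda>i. (i, 0)) ` Basis) F}"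
proof (intro subsetI CollectI)
  fix u
  assume "u \<in> subdiff_inf Basis (marginal F)"
  then have u: "(u, -1) \<bullet> w \<le> 0"
    if "w \<in> tangent_inf ((\<lambda>i. (i, 0)) ` Basis) (epi (marginal F))" for w
    using that by (simp add: subdiff_inf_def normal_inf_def)
  show "(u, 0) \<in> subdiff_inf ((\<lambda>i. (i, 0)) ` Basis) F"
    unfolding subdiff_inf_def normal_inf_def
  proof (intro CollectI ballI)
    fix w :: "((real ^ 'n) \<times> (real ^ 'p)) \<times> real"
    assume w: "w \<in> tangent_inf ((\<lambda>i. (i, 0)) ` (\<lambda>i. (i, 0)) ` Basis) (epi F)"
    obtain a b c where abc: "w = ((a, b), c)"
      by (metis prod.exhaust)
    \<comment> \<open>The zero entry cancels \<open>b\<close>, so this product equals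
      \<open>(u, -1) \<bullet> (a, c)\<close>.\<close>
    show "((u, 0), -1) \<bullet> w \<le> 0"
      using u[OF tangent_inf_epi_marginal[OF assms(7) w[unfolded abc]]] by (simp add: abc)
  qed
qed

end
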